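(* Let $G$ be a connected graph and let $E_{V(G)}$ be the set of vertices of $G$ of even degree in $G$. Then $\gamma_{coe}(G\circ K_1)=|V(G)|+|E_{V(G)}|$.
   Context: All graphs are finite and simple. A dominating set of a graph $X=(V,E)$ is a set $D\subseteq V$ such that every vertex in $V\setminus D$ is adjacent to at least one vertex of $D$. A dominating set $D$ is a co-even dominating set if every vertex $v\in V\setminus D$ has even degree in $X$. The co-even domination number $\gamma_{coe}(X)$ is the minimum cardinality of a co-even dominating set of $X$. The corona $G\circ K_1$ is the graph obtained from $G$ by adding, for each vertex $v\in V(G)$, a new vertex $v'$ and the pendant edge $vv'$. *)

theory Defs
  imports "Graph_Theory.Graph_Theory"
begin

text \<open>
  A finite simple graph is a \<^locale>\<open>pair_graph\<close>: a finite vertex set \<open>pverts G\<close> with a symmetric,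
  loop-free adjacency relation \<open>parcs G\<close>. Every undirected edge \<open>uv\<close> is represented by the two arcs
  \<open>(u,v)\<close> and \<open>(v,u)\<close>, so the degree of \<open>v\<close> is its out-degree (see \<open>vertex_degree_conv\<close> below), not the
  sum of its in- and out-degree.
\<close>

abbreviation vertex_degree :: "'a pair_pre_digraph \<Rightarrow> 'a \<Rightarrow> nat" where
  "vertex_degree X v \<equiv> out_degree (with_proj X) v"

definition even_degree_verts :: "'a pair_pre_digraph \<Rightarrow> 'a set" where
  "even_degree_verts X = {v \<in> pverts X. even (vertex_degree X v)}"

definition dominating_set :: "'a pair_pre_digraph \<Rightarrow> 'a set \<Rightarrow> bool" where
  "dominating_set X D \<longleftrightarrow>
     D \<subseteq> pverts X \<and> (\<forall>v \<in> pverts X - D. \<exists>u \<in> D. (v, u) \<in> parcs X)"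

definition coeven_dominating_set :: "'a pair_pre_digraph \<Rightarrow> 'a set \<Rightarrow> bool" where
  "coeven_dominating_set X D \<longleftrightarrow>
     dominating_set X D \<and> (\<forall>v \<in> pverts X - D. even (vertex_degree X v))"

text \<open>The minimum exists, since \<open>pverts X\<close> itself is a co-even dominating set.\<close>

definition coeven_domination_number :: "'a pair_pre_digraph \<Rightarrow> nat" where
  "coeven_domination_number X = (LEAST k. \<exists>D. coeven_dominating_set X D \<and> card D = k)"

text \<open>\<open>Inl v\<close> is the original vertex \<open>v\<close>, and \<open>Inr v\<close> is the new vertex \<open>v'\<close> attached to it.\<close>

definition corona_K1 :: "'a pair_pre_digraph \<Rightarrow> ('a + 'a) pair_pre_digraph" where
  "corona_K1 G = \<lparr>
     pverts = pverts G <+> pverts G,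
     parcs = {(Inl u, Inl v) |u v. (u, v) \<in> parcs G}
       \<union> {(Inl v, Inr v) |v. v \<in> pverts G}
       \<union> {(Inr v, Inl v) |v. v \<in> pverts G} \<rparr>"

lemma vertex_degree_conv: "vertex_degree X v = card {u. (v, u) \<in> parcs X}"
proof -
  have "out_arcs (with_proj X) v = Pair v ` {u. (v, u) \<in> parcs X}"
    by (auto simp: out_arcs_def)
  then show ?thesis
    by (simp add: out_degree_def card_image inj_on_def)
qed

lemma pair_graph_corona_K1:
  assumes "pair_graph G"
  shows "pair_graph (corona_K1 G)"
proof -
  interpret pair_graph G by fact
  have "parcs (corona_K1 G) \<subseteq> (pverts G <+> pverts G) \<times> (pverts G <+> pverts G)"
    by (auto simp: corona_K1_def dest: in_arcsD1 in_arcsD2)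
  then have "finite (parcs (corona_K1 G))"
    using pair_finite_verts by (meson finite_Plus finite_SigmaI finite_subset)
  then show ?thesis
    using pair_finite_verts
    by unfold_locales
      (auto simp: corona_K1_def symmetric_def sym_def dest: in_arcsD1 in_arcsD2 arcs_symmetric no_loops')
qed

lemma coeven_dominating_set_pverts: "coeven_dominating_set X (pverts X)"
  by (simp add: coeven_dominating_set_def dominating_set_def)

end

theory Submission
  imports Defs
begin

text \<open>Attaching a pendant vertex flips the parity of every original degree, and each pendant
  vertex has degree 1. Hence the odd-degree vertices of the corona are the pendant ones together
  with the copies of the even-degree vertices of \<open>G\<close>. Parity forces all of them into
  every co-even dominating set. They also suffice, since each remaining vertex is dominated by its
  own pendant neighbour. So the co-even dominating sets are the supersets of this forced set
  (\<open>coeven_dominating_set_corona_K1_iff\<close>), whose size is the minimum.\<close>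

lemma vertex_degree_corona_K1_Inl:
  assumes "pair_graph G" and "v \<in> pverts G"
  shows "vertex_degree (corona_K1 G) (Inl v) = Suc (vertex_degree G v)"
proof -
  interpret pair_graph G by fact
  have "{x. (Inl v, x) \<in> parcs (corona_K1 G)} = insert (Inr v) (Inl ` {u. (v, u) \<in> parcs G})"
    using assms(2) by (auto simp: corona_K1_def)
  moreover have "finite {u. (v, u) \<in> parcs G}"
    by (rule finite_subset[OF _ pair_finite_verts]) (auto dest: in_arcsD2)
  ultimately show ?thesis
    by (simp add: vertex_degree_conv card_image card_insert_if image_iff)
qed

lemma vertex_degree_corona_K1_Inr:
  assumes "v \<in> pverts G"
  shows "vertex_degree (corona_K1 G) (Inr v) = 1"
proof -
  have "{x. (Inr v, x) \<in> parcs (corona_K1 G)} = {Inl v}"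
    using assms by (auto simp: corona_K1_def)
  then show ?thesis
    by (simp add: vertex_degree_conv)
qed

text \<open>Necessity uses only parity, and domination then comes for free. The equivalence form
  allows rewriting under \<open>LEAST\<close>, which yields both bounds at once.\<close>

lemma coeven_dominating_set_corona_K1_iff:
  assumes "pair_graph G"
  shows "coeven_dominating_set (corona_K1 G) D \<longleftrightarrow>
    even_degree_verts G <+> pverts G \<subseteq> D \<and> D \<subseteq> pverts (corona_K1 G)"
    (is "_ \<longleftrightarrow> ?M \<subseteq> D \<and> D \<subseteq> ?V")
proof
  assume D: "coeven_dominating_set (corona_K1 G) D"
  have "x \<in> D" if "x \<in> ?M" for x
  proof (rule ccontr)
    assume "x \<notin> D"
    moreover have "x \<in> ?V"
      using that by (auto simp: corona_K1_def even_degree_verts_def)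
    ultimately have "even (vertex_degree (corona_K1 G) x)"
      using D by (auto simp: coeven_dominating_set_def)
    \<comment> \<open>Both summands of \<open>?M\<close> have odd degree in the corona: the
      successor of an even number on the left, 1 on the right.\<close>
    with that show False
      using assms
      by (auto simp: even_degree_verts_def vertex_degree_corona_K1_Inl vertex_degree_corona_K1_Inr)
  qed
  with D show "?M \<subseteq> D \<and> D \<subseteq> ?V"
    by (auto simp: coeven_dominating_set_def dominating_set_def)
next
  assume D: "?M \<subseteq> D \<and> D \<subseteq> ?V"
  have "(\<exists>u\<in>D. (x, u) \<in> parcs (corona_K1 G)) \<and> even (vertex_degree (corona_K1 G) x)"
    if x: "x \<in> ?V - D" for x
  proof -
    \<comment> \<open>All pendant vertices lie in \<open>?M\<close>, hence in \<open>D\<close>, so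
      \<open>x\<close> must be an original vertex.\<close>
    obtain v where v: "x = Inl v" "v \<in> pverts G" "v \<notin> even_degree_verts G"
      using x D by (auto simp: corona_K1_def)
    moreover have "Inr v \<in> D"
      using v D by auto
    moreover have "(Inl v, Inr v) \<in> parcs (corona_K1 G)"
      using v by (auto simp: corona_K1_def)
    ultimately show ?thesis
      using assms by (auto simp: even_degree_verts_def vertex_degree_corona_K1_Inl)
  qed
  with D show "coeven_dominating_set (corona_K1 G) D"
    by (auto simp: coeven_dominating_set_def dominating_set_def)
qed

theorem theorem2p4:
  fixes G :: "'a pair_pre_digraph"
  assumes "pair_graph G" and "connected (with_proj G)"
  shows "coeven_domination_number (corona_K1 G) = card (pverts G) + card (even_degree_verts G)"
proof -
  interpret pair_graph G by fact
  interpret C: pair_graph "corona_K1 G"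
    using assms(1) by (rule pair_graph_corona_K1)
  let ?M = "even_degree_verts G <+> pverts G"
  have "even_degree_verts G \<subseteq> pverts G"
    by (auto simp: even_degree_verts_def)
  then have "finite (even_degree_verts G)"
    using pair_finite_verts by (rule finite_subset)
  then have card: "card ?M = card (pverts G) + card (even_degree_verts G)"
    using pair_finite_verts by (simp add: card_Plus)
  have "?M \<subseteq> pverts (corona_K1 G)"
    by (auto simp: corona_K1_def even_degree_verts_def)
  \<comment> \<open>Monotonicity of \<open>card\<close> requires \<open>D\<close> to be finite; this
    comes from the finite corona, via \<open>C\<close>.\<close>
  moreover have "card ?M \<le> card D" if "?M \<subseteq> D" "D \<subseteq> pverts (corona_K1 G)" for D
    using that C.pair_finite_verts by (meson card_mono finite_subset)
  ultimately have "coeven_domination_number (corona_K1 G) = card ?M"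
    unfolding coeven_domination_number_def coeven_dominating_set_corona_K1_iff[OF assms(1)]
    by (intro Least_equality) auto
  with card show ?thesis
    by simp
qed

end
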